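(* Every star is $\mathbb{Z}_2\times\mathbb{Z}_2$-cordial.
   Context: A star is a finite hypergraph with at least one edge, every edge having at least two vertices, in which there is a vertex $x$ (the center) contained in all edges, the edges are pairwise disjoint apart from $x$, and every vertex lies in some edge (edge sizes may differ). Let $A=\mathbb{Z}_2\times\mathbb{Z}_2$. For a hypergraph $H=(V,E)$ and a labeling $c:V\to A$, write $v_c(a)=|c^{-1}(a)|$; $c$ is $A$-friendly if $|v_c(a)-v_c(b)|\le 1$ for all $a,b\in A$. It induces $c^*:E\to A$, $c^*(e)=\sum_{v\in e}c(v)$; write $e_{c^*}(a)=|(c^* )^{-1}(a)|$. $H$ is $A$-cordial if it admits an $A$-friendly labeling $c$ with $|e_{c^*}(a)-e_{c^*}(b)|\le 1$ for all $a,b\in A$. *)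

theory Defs
  imports Main "HOL-Library.Z2" "HOL-Library.Product_Plus"
begin

type_synonym grpA = "bit \<times> bit"

definition hypergraph :: "'v set \<Rightarrow> 'v set set \<Rightarrow> bool" where
  "hypergraph V E \<longleftrightarrow> finite V \<and> (\<forall>e\<in>E. e \<subseteq> V)"

definition is_star :: "'v set \<Rightarrow> 'v set set \<Rightarrow> bool" where
  "is_star V E \<longleftrightarrow> hypergraph V E \<and> E \<noteq> {} \<and> (\<forall>e\<in>E. card e \<ge> 2) \<and>
     (\<exists>x. (\<forall>e\<in>E. x \<in> e) \<and> (\<forall>e1\<in>E. \<forall>e2\<in>E. e1 \<noteq> e2 \<longrightarrow> e1 \<inter> e2 = {x})) \<and>
     (\<forall>v\<in>V. \<exists>e\<in>E. v \<in> e)"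

definition vcount :: "'v set \<Rightarrow> ('v \<Rightarrow> grpA) \<Rightarrow> grpA \<Rightarrow> nat" where
  "vcount V c a = card {v\<in>V. c v = a}"

definition induced :: "('v \<Rightarrow> grpA) \<Rightarrow> 'v set \<Rightarrow> grpA" where
  "induced c e = (\<Sum>v\<in>e. c v)"

definition ecount :: "'v set set \<Rightarrow> ('v \<Rightarrow> grpA) \<Rightarrow> grpA \<Rightarrow> nat" where
  "ecount E c a = card {e\<in>E. induced c e = a}"

definition A_friendly :: "'v set \<Rightarrow> ('v \<Rightarrow> grpA) \<Rightarrow> bool" where
  "A_friendly V c \<longleftrightarrow> (\<forall>a b. \<bar>int (vcount V c a) - int (vcount V c b)\<bar> \<le> 1)"

definition A_cordial :: "'v set \<Rightarrow> 'v set set \<Rightarrow> bool" where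
  "A_cordial V E \<longleftrightarrow> (\<exists>c. A_friendly V c \<and>
      (\<forall>a b. \<bar>int (ecount E c a) - int (ecount E c b)\<bar> \<le> 1))"

end

theory Submission
  imports Defs
begin

text \<open>
  Remove the center from every edge and label the resulting disjoint petals one after the other.
  Only the numbers of vertices and of petals carrying each label matter, and both only up to adding
  a constant to all four of them. In particular four vertices of a petal that carry four different
  labels sum to \<open>0\<close> and can be ignored, so a petal acts through its size modulo \<open>4\<close>. If the
  petals of size \<open>1\<close> modulo \<open>4\<close> come first, then those of size \<open>3\<close> modulo \<open>4\<close>, then those
  of even size, the labels can be chosen such that the pair of normalized counts never leaves a
  list of \<open>17\<close> states. In each of these states the petal sums are balanced and some label of the
  center balances the vertices; that label shifts all edge sums by the same group element, so the
  edges remain balanced.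
\<close>

section \<open>Quadruples of label counts and transitions between states\<close>

type_synonym quad = "nat \<times> nat \<times> nat \<times> nat"

fun quad_at :: "quad \<Rightarrow> grpA \<Rightarrow> nat" where
  "quad_at (n0, n1, n2, n3) (i, j) =
     (if i = 0 then if j = 0 then n0 else n1 else if j = 0 then n2 else n3)"

fun bump :: "bool \<Rightarrow> bool \<Rightarrow> quad \<Rightarrow> quad" where
  "bump False False (n0, n1, n2, n3) = (Suc n0, n1, n2, n3)"
| "bump False True (n0, n1, n2, n3) = (n0, Suc n1, n2, n3)"
| "bump True False (n0, n1, n2, n3) = (n0, n1, Suc n2, n3)"
| "bump True True (n0, n1, n2, n3) = (n0, n1, n2, Suc n3)"

fun quad_min :: "quad \<Rightarrow> nat" where
  "quad_min (n0, n1, n2, n3) = min (min n0 n1) (min n2 n3)"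

fun normalize :: "quad \<Rightarrow> quad" where
  "normalize (n0, n1, n2, n3) = (let k = quad_min (n0, n1, n2, n3) in (n0 - k, n1 - k, n2 - k, n3 - k))"

fun quad_add :: "quad \<Rightarrow> quad \<Rightarrow> quad" where
  "quad_add (m0, m1, m2, m3) (n0, n1, n2, n3) = (m0 + n0, m1 + n1, m2 + n2, m3 + n3)"

fun flat :: "quad \<Rightarrow> bool" where
  "flat (n0, n1, n2, n3) \<longleftrightarrow> (\<forall>x\<in>{n0, n1, n2, n3}. \<forall>y\<in>{n0, n1, n2, n3}. x \<le> Suc y)"

text \<open>In the label order of \<open>quad_at\<close>, the entries \<open>n2\<close>,
  \<open>n3\<close> count the labels with first coordinate 1 and \<open>n1\<close>,
  \<open>n3\<close> those with second coordinate 1, so the two parities form the sum of the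
  petal.\<close>

fun step :: "quad \<Rightarrow> quad \<times> quad \<Rightarrow> quad \<times> quad" where
  "step (n0, n1, n2, n3) (v, e) =
     (normalize (quad_add v (n0, n1, n2, n3)),
      normalize (bump (odd (n2 + n3)) (odd (n1 + n3)) e))"

text \<open>An explicit list makes \<open>closed_under\<close> executable. The ranges keep all
  truncated subtractions exact, so every entry has total \<open>r\<close>.\<close>

definition quads :: "nat \<Rightarrow> quad list" where
  "quads r = [(n0, n1, n2, r - n0 - n1 - n2).
     n0 \<leftarrow> [0..<Suc r], n1 \<leftarrow> [0..<Suc (r - n0)], n2 \<leftarrow> [0..<Suc (r - n0 - n1)]]"

text \<open>This is a winning strategy in a game: whatever state is current, a petal of class
  \<open>r\<close> can be answered without leaving \<open>S\<close>.\<close>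

definition closed_under :: "nat \<Rightarrow> (quad \<times> quad) list \<Rightarrow> bool" where
  "closed_under r S \<longleftrightarrow> (\<forall>s\<in>set S. \<exists>q\<in>set (quads r). step q s \<in> set S)"

text \<open>
  The states were found by computer search. The order of the phases matters: if petals of
  all four size classes arrive in arbitrary order, no strategy labeling each petal on arrival keeps
  all counts balanced.
\<close>

definition states1 :: "(quad \<times> quad) list" where
  "states1 = [
    ((0, 0, 0, 0), (0, 0, 0, 0)), ((0, 0, 0, 1), (0, 0, 0, 1)), ((0, 1, 0, 1), (0, 1, 0, 1)),
    ((0, 1, 1, 1), (0, 1, 1, 1))]"

definition states3 :: "(quad \<times> quad) list" where
  "states3 = states1 @ [
    ((0, 0, 1, 0), (1, 1, 0, 1)), ((0, 1, 2, 1), (0, 1, 0, 1)), ((0, 2, 2, 2), (0, 0, 0, 0)),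
    ((1, 0, 1, 1), (0, 1, 0, 0))]"

definition states_even :: "(quad \<times> quad) list" where
  "states_even = states3 @ [
    ((0, 0, 1, 1), (0, 1, 0, 0)), ((0, 1, 1, 1), (0, 0, 0, 0)), ((0, 1, 1, 2), (0, 0, 0, 1)),
    ((0, 1, 2, 1), (1, 1, 0, 1)), ((0, 2, 2, 2), (0, 1, 1, 1)), ((1, 0, 0, 0), (0, 0, 0, 0)),
    ((1, 1, 0, 1), (0, 1, 0, 1)), ((1, 1, 0, 1), (1, 1, 0, 1)), ((2, 0, 1, 2), (0, 1, 0, 1))]"

section \<open>Finite checks on the state lists\<close>

lemma closed_states1: "closed_under 1 states1"
  by code_simp

lemma closed_states3: "closed_under 3 states3"
  by code_simp

text \<open>Sizes divisible by 4 are treated with remainder 4, not 0: remainder 0 would force the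
  sum 0 on every such petal, while four free vertices leave a choice of sum.\<close>

lemma closed_states_even: "closed_under 2 states_even" "closed_under 4 states_even"
  by code_simp+

lemma flat_states_even:
  "\<forall>(v, e)\<in>set states_even. flat e \<and> (\<exists>i\<in>{False, True}. \<exists>j\<in>{False, True}. flat (bump i j v))"
  by code_simp

text \<open>Nesting lets each phase start from any state in which the previous one ended.\<close>

lemma states_subset: "set states1 \<subseteq> set states3" "set states3 \<subseteq> set states_even"
  by (auto simp: states3_def states_even_def)

section \<open>Quadruples as functions on the group, and sums of bits\<close>

lemma quad_at_quad_add: "quad_at (quad_add p q) a = quad_at p a + quad_at q a"
  by (cases p; cases q; cases a) auto

lemma quad_at_normalize: "quad_at q a = quad_min q + quad_at (normalize q) a"
  by (cases q; cases a) (auto simp: Let_def)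

lemma quad_at_bump: "quad_at (bump i j q) a = quad_at q a + of_bool (a = (of_bool i, of_bool j))"
  by (cases i; cases j; cases q; cases a) (auto split: if_splits)

lemma flat_le: "flat q \<Longrightarrow> quad_at q a \<le> Suc (quad_at q b)"
  by (cases q; cases a; cases b) auto

lemma UNIV_grpA: "(UNIV :: grpA set) = {(0, 0), (0, 1), (1, 0), (1, 1)}"
proof (rule set_eqI)
  fix a :: grpA
  show "a \<in> UNIV \<longleftrightarrow> a \<in> {(0, 0), (0, 1), (1, 0), (1, 1)}"
    by (cases a) auto
qed

lemma of_nat_bit_eq: "(of_nat n :: bit) = of_bool (odd n)"
  by (induction n) auto

lemma sum_bit_eq_of_bool:
  fixes h :: "'v \<Rightarrow> bit"
  assumes "finite P"
  shows "(\<Sum>x\<in>P. h x) = of_bool (odd (card {x\<in>P. h x = 1}))"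
proof -
  have "(\<Sum>x\<in>P. h x) = (\<Sum>x\<in>{x\<in>P. h x = 1}. 1)"
    using assms by (intro sum.mono_neutral_cong_right) auto
  also have "\<dots> = of_nat (card {x\<in>P. h x = 1})"
    by simp
  also have "\<dots> = of_bool (odd (card {x\<in>P. h x = 1}))"
    by (rule of_nat_bit_eq)
  finally show ?thesis .
qed

section \<open>Adding a single petal\<close>

lemma exists_labeling_with_counts:
  fixes n :: "'a \<Rightarrow> nat"
  assumes "finite (UNIV :: 'a set)" "finite P" "card P = (\<Sum>a\<in>UNIV. n a)"
  obtains f where "\<And>a. card {x\<in>P. f x = a} = n a"
proof -
  \<comment> \<open>\<open>Z\<close> is a disjoint union of fibers of the prescribed sizes; a
    bijection from \<open>P\<close> to \<open>Z\<close> followed by the first projection is the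
    labeling.\<close>
  define Z where "Z = (SIGMA a:UNIV. {..<n a})"
  have "finite Z" "card Z = card P"
    using assms by (auto simp: Z_def)
  then obtain h where h: "bij_betw h P Z"
    using \<open>finite P\<close> by (metis finite_same_card_bij)
  have "card {x\<in>P. fst (h x) = a} = n a" for a
  proof -
    have "bij_betw h {x\<in>P. fst (h x) = a} {z\<in>Z. fst z = a}"
      using h by (auto simp: bij_betw_def inj_on_def)
    moreover have "{z\<in>Z. fst z = a} = {a} \<times> {..<n a}"
      by (auto simp: Z_def)
    ultimately show ?thesis
      by (simp add: bij_betw_same_card)
  qed
  then show thesis
    by (rule that)
qed

lemma quads_sum: "(n0, n1, n2, n3) \<in> set (quads r) \<Longrightarrow> n0 + n1 + n2 + n3 = r"
  by (auto simp: quads_def simp del: upt_Suc)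

text \<open>The constants \<open>k\<close> and \<open>l\<close> do not depend on \<open>a\<close>,
  so they vanish from all differences of counts. The members of \<open>Q\<close> are petals, so the
  center is not yet counted.\<close>

definition realizes :: "'v set set \<Rightarrow> ('v \<Rightarrow> grpA) \<Rightarrow> quad \<times> quad \<Rightarrow> bool" where
  "realizes Q c s \<longleftrightarrow>
     (\<exists>k. \<forall>a. vcount (\<Union>Q) c a = k + quad_at (fst s) a) \<and> (\<exists>l. \<forall>a. ecount Q c a = l + quad_at (snd s) a)"

text \<open>Each label is used \<open>m\<close> times in addition to the counts prescribed by
  \<open>q\<close>; these extra vertices sum to 0.\<close>

lemma exists_petal_labeling:
  assumes "finite P" and q: "q \<in> set (quads r)" and card: "card P = 4 * m + r"
    and q_eq: "q = (n0, n1, n2, n3)"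
  obtains f where "\<And>a. card {x\<in>P. f x = a} = m + quad_at q a"
    and "induced f P = (of_bool (odd (n2 + n3)), of_bool (odd (n1 + n3)))"
proof -
  have "card P = (\<Sum>a\<in>UNIV. m + quad_at q a)"
    using card quads_sum[OF q[unfolded q_eq]] by (simp add: UNIV_grpA q_eq)
  then obtain f where f: "\<And>a. card {x\<in>P. f x = a} = m + quad_at q a"
    using exists_labeling_with_counts[of P "\<lambda>a. m + quad_at q a"] \<open>finite P\<close> UNIV_grpA
    by (metis finite.intros)
  have "{x\<in>P. fst (f x) = 1} = {x\<in>P. f x = (1, 0)} \<union> {x\<in>P. f x = (1, 1)}"
    by (auto simp: prod_eq_iff)
  then have "card {x\<in>P. fst (f x) = 1} = card {x\<in>P. f x = (1, 0)} + card {x\<in>P. f x = (1, 1)}"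
    using \<open>finite P\<close> by (simp add: card_Un_disjoint disjoint_iff)
  \<comment> \<open>The cardinality is \<open>2 * m + n2 + n3\<close>, so \<open>m\<close>
    disappears modulo 2.\<close>
  then have 1: "odd (card {x\<in>P. fst (f x) = 1}) \<longleftrightarrow> odd (n2 + n3)"
    by (simp add: f q_eq) presburger
  have "{x\<in>P. snd (f x) = 1} = {x\<in>P. f x = (0, 1)} \<union> {x\<in>P. f x = (1, 1)}"
    by (auto simp: prod_eq_iff)
  then have "card {x\<in>P. snd (f x) = 1} = card {x\<in>P. f x = (0, 1)} + card {x\<in>P. f x = (1, 1)}"
    using \<open>finite P\<close> by (simp add: card_Un_disjoint disjoint_iff)
  then have 2: "odd (card {x\<in>P. snd (f x) = 1}) \<longleftrightarrow> odd (n1 + n3)"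
    by (simp add: f q_eq) presburger
  have "induced f P = (of_bool (odd (n2 + n3)), of_bool (odd (n1 + n3)))"
    unfolding induced_def
    by (simp only: prod_eq_iff fst_sum snd_sum sum_bit_eq_of_bool[OF \<open>finite P\<close>] 1 2 fst_conv snd_conv)
  with f show thesis
    by (rule that)
qed

lemma realizes_insert:
  assumes "finite Q" "finite (\<Union>Q)" "finite P" "P \<noteq> {}" and disj: "P \<inter> \<Union>Q = {}"
    and real: "realizes Q c s" and q: "q \<in> set (quads r)" and card: "card P = 4 * m + r"
  obtains c' where "realizes (insert P Q) c' (step q s)"
proof -
  obtain n0 n1 n2 n3 where q_eq: "q = (n0, n1, n2, n3)"
    by (cases q)
  obtain v e where s: "s = (v, e)"
    by (cases s)
  obtain k l where k: "\<And>a. vcount (\<Union>Q) c a = k + quad_at v a" and l: "\<And>a. ecount Q c a = l + quad_at e a"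
    using real by (auto simp: realizes_def s)
  obtain f where f: "\<And>a. card {x\<in>P. f x = a} = m + quad_at q a"
    and sum_f: "induced f P = (of_bool (odd (n2 + n3)), of_bool (odd (n1 + n3)))"
    using exists_petal_labeling[OF \<open>finite P\<close> q card q_eq] by blast
  define c' where "c' = (\<lambda>x. if x \<in> P then f x else c x)"
  define e' where "e' = bump (odd (n2 + n3)) (odd (n1 + n3)) e"
  \<comment> \<open>Disjointness alone would still allow \<open>P\<close> to be an empty member of
    \<open>Q\<close>, and then the petal count would not grow.\<close>
  have "P \<notin> Q"
    using disj \<open>P \<noteq> {}\<close> by blast
  \<comment> \<open>The new constant collects the old one, the \<open>m\<close> uses of every label
    in \<open>P\<close>, and the minimum removed by \<open>normalize\<close>.\<close>
  have v': "vcount (\<Union>(insert P Q)) c' a = (k + m + quad_min (quad_add v q)) + quad_at (normalize (quad_add v q)) a" for a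
  proof -
    have "{x\<in>\<Union>(insert P Q). c' x = a} = {x\<in>P. f x = a} \<union> {x\<in>\<Union>Q. c x = a}"
      using disj by (auto simp: c'_def)
    moreover have "{x\<in>P. f x = a} \<inter> {x\<in>\<Union>Q. c x = a} = {}"
      using disj by blast
    ultimately have "vcount (\<Union>(insert P Q)) c' a = card {x\<in>P. f x = a} + vcount (\<Union>Q) c a"
      unfolding vcount_def using \<open>finite P\<close> \<open>finite (\<Union>Q)\<close>
      by (subst card_Un_disjoint[symmetric]) (auto intro: finite_subset[of _ "\<Union>Q"])
    then show ?thesis
      using quad_at_quad_add[of v q a] quad_at_normalize[of "quad_add v q" a] f[of a] k[of a] by linarith
  qed
  have e': "ecount (insert P Q) c' a = (l + quad_min e') + quad_at (normalize e') a" for a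
  proof -
    have P: "induced c' P = induced f P"
      by (simp add: induced_def c'_def)
    have R: "induced c' R = induced c R" if "R \<in> Q" for R
      unfolding induced_def c'_def using that disj by (intro sum.cong) auto
    have "{R\<in>insert P Q. induced c' R = a} =
        (if induced f P = a then {P} else {}) \<union> {R\<in>Q. induced c R = a}"
      using P R \<open>P \<notin> Q\<close> by auto
    then have "ecount (insert P Q) c' a = ecount Q c a + of_bool (a = induced f P)"
      unfolding ecount_def using \<open>finite Q\<close> \<open>P \<notin> Q\<close> by auto
    then show ?thesis
      using quad_at_bump[of "odd (n2 + n3)" "odd (n1 + n3)" e a] quad_at_normalize[of e' a] l[of a]
      unfolding sum_f e'_def by linarith
  qed
  have "realizes (insert P Q) c' (step q s)"
    unfolding realizes_def s q_eq step.simps fst_conv snd_conv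
    using v' e' unfolding q_eq e'_def by blast
  then show thesis
    by (rule that)
qed

section \<open>Labeling all petals phase by phase\<close>

lemma realizes_extend:
  assumes "finite R" "finite Q" "finite (\<Union>Q)" "pairwise disjnt (Q \<union> R)" "Q \<inter> R = {}"
    and R: "\<And>P. P \<in> R \<Longrightarrow> finite P \<and> P \<noteq> {} \<and> (\<exists>m r. card P = 4 * m + r \<and> closed_under r S)"
    and start: "\<exists>c. \<exists>s\<in>set S. realizes Q c s"
  shows "\<exists>c. \<exists>s\<in>set S. realizes (Q \<union> R) c s"
  using assms(1) subset_refl[of R]
\<comment> \<open>The petals of \<open>R\<close> arrive one at a time in any order, and
  \<open>r\<close> may differ from petal to petal, as it does in the even phase.\<close>
proof (induction rule: finite_subset_induct')
  case empty
  then show ?case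
    using start by simp
next
  case (insert P F)
  then obtain c s where s: "s \<in> set S" and real: "realizes (Q \<union> F) c s"
    by blast
  obtain m r where P: "finite P" "P \<noteq> {}" "card P = 4 * m + r" and "closed_under r S"
    using R \<open>P \<in> R\<close> by blast
  then obtain q where q: "q \<in> set (quads r)" and step: "step q s \<in> set S"
    using s unfolding closed_under_def by blast
  have "disjnt P P'" if "P' \<in> Q \<union> F" for P'
  proof -
    have "P \<noteq> P'"
      using that \<open>P \<in> R\<close> \<open>P \<notin> F\<close> \<open>Q \<inter> R = {}\<close> by blast
    then show ?thesis
      using that \<open>P \<in> R\<close> \<open>F \<subseteq> R\<close> pairwiseD[OF assms(4), of P P'] by blast
  qed
  then have "P \<inter> \<Union>(Q \<union> F) = {}"
    by (auto simp: disjnt_def)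
  moreover have "finite (Q \<union> F)" "finite (\<Union>(Q \<union> F))"
    using insert.hyps assms(2,3) R by auto
  ultimately obtain c' where "realizes (insert P (Q \<union> F)) c' (step q s)"
    using realizes_insert[OF _ _ P(1,2) _ real q P(3)] by blast
  then show ?case
    using step by auto
qed

lemma exists_petals_labeling:
  assumes fin: "finite Q" and Q: "\<And>P. P \<in> Q \<Longrightarrow> finite P \<and> P \<noteq> {}" and disj: "pairwise disjnt Q"
  shows "\<exists>c. \<exists>s\<in>set states_even. realizes Q c s"
proof -
  define Q1 where "Q1 = {P\<in>Q. card P mod 4 = 1}"
  define Q3 where "Q3 = {P\<in>Q. card P mod 4 = 3}"
  define Q0 where "Q0 = {P\<in>Q. even (card P)}"
  have Q_eq: "Q = Q1 \<union> Q3 \<union> Q0"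
    unfolding Q1_def Q3_def Q0_def by (auto; presburger)
  have sub: "Q1 \<subseteq> Q" "Q3 \<subseteq> Q" "Q1 \<union> Q3 \<subseteq> Q"
    unfolding Q1_def Q3_def by auto
  have finU: "finite (\<Union>Q')" if "Q' \<subseteq> Q" for Q'
    using that fin Q by (meson finite_Union finite_subset subsetD)
  have pw: "pairwise disjnt Q'" if "Q' \<subseteq> Q" for Q'
    using disj that by (rule pairwise_subset)
  have "realizes {} c ((0, 0, 0, 0), (0, 0, 0, 0))" for c :: "'a \<Rightarrow> grpA"
    by (auto simp: realizes_def vcount_def ecount_def)
  moreover have "((0, 0, 0, 0), (0, 0, 0, 0)) \<in> set states1"
    by (simp add: states1_def)
  ultimately have "\<exists>c :: 'a \<Rightarrow> grpA. \<exists>s\<in>set states1. realizes {} c s"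
    by blast
  then have "\<exists>c. \<exists>s\<in>set states1. realizes ({} \<union> Q1) c s"
  proof (rule realizes_extend[rotated -1])
    fix P assume P: "P \<in> Q1"
    then have "card P = 4 * (card P div 4) + 1"
      unfolding Q1_def by (metis (mono_tags, lifting) mem_Collect_eq mult_div_mod_eq)
    then show "finite P \<and> P \<noteq> {} \<and> (\<exists>m r. card P = 4 * m + r \<and> closed_under r states1)"
      using closed_states1 Q P sub by blast
  qed (use fin sub in \<open>auto intro: finite_subset pw\<close>)
  then have "\<exists>c. \<exists>s\<in>set states3. realizes Q1 c s"
    using states_subset by auto
  then have "\<exists>c. \<exists>s\<in>set states3. realizes (Q1 \<union> Q3) c s"
  proof (rule realizes_extend[rotated -1])
    fix P assume P: "P \<in> Q3"
    then have "card P = 4 * (card P div 4) + 3"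
      unfolding Q3_def by (metis (mono_tags, lifting) mem_Collect_eq mult_div_mod_eq)
    then show "finite P \<and> P \<noteq> {} \<and> (\<exists>m r. card P = 4 * m + r \<and> closed_under r states3)"
      using closed_states3 Q P sub by blast
  qed (use fin sub finU pw in \<open>auto intro: finite_subset simp: Q1_def Q3_def\<close>)
  then have "\<exists>c. \<exists>s\<in>set states_even. realizes (Q1 \<union> Q3) c s"
    using states_subset by blast
  then have "\<exists>c. \<exists>s\<in>set states_even. realizes (Q1 \<union> Q3 \<union> Q0) c s"
  proof (rule realizes_extend[rotated -1])
    fix P assume P: "P \<in> Q0"
    then have "P \<in> Q" "even (card P)"
      by (auto simp: Q0_def)
    moreover have "card P \<noteq> 0"
      using Q \<open>P \<in> Q\<close> by auto
    \<comment> \<open>A nonempty petal of size divisible by 4 has at least 4 vertices, which permits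
      the remainder 4.\<close>
    ultimately have "\<exists>m. card P = 4 * m + 2 \<or> card P = 4 * m + 4"
      by presburger
    then show "finite P \<and> P \<noteq> {} \<and> (\<exists>m r. card P = 4 * m + r \<and> closed_under r states_even)"
      using closed_states_even Q \<open>P \<in> Q\<close> by blast
  next
    show "(Q1 \<union> Q3) \<inter> Q0 = {}"
      unfolding Q1_def Q3_def Q0_def by (auto; presburger)
  qed (use fin sub finU pw Q_eq in \<open>auto intro: finite_subset\<close>)
  then show ?thesis
    using Q_eq by simp
qed

section \<open>From petals to edges: labeling the center\<close>

theorem theorem4:
  fixes V :: "'v set" and E :: "'v set set"
  assumes "is_star V E"
  shows "A_cordial V E"
proof -
  have "finite V" and sub: "\<And>e. e \<in> E \<Longrightarrow> e \<subseteq> V" and "E \<noteq> {}"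
    and card: "\<And>e. e \<in> E \<Longrightarrow> card e \<ge> 2" and cover: "\<And>v. v \<in> V \<Longrightarrow> \<exists>e\<in>E. v \<in> e"
    using assms by (simp_all add: is_star_def hypergraph_def)
  obtain x where x: "\<And>e. e \<in> E \<Longrightarrow> x \<in> e"
    and disj: "\<And>e1 e2. e1 \<in> E \<Longrightarrow> e2 \<in> E \<Longrightarrow> e1 \<noteq> e2 \<Longrightarrow> e1 \<inter> e2 = {x}"
    using assms unfolding is_star_def by (elim conjE exE) (metis (no_types))
  define petal where "petal e = e - {x}" for e
  \<comment> \<open>Putting \<open>x\<close> back recovers an edge from its petal, so petal counts
    transfer to edges.\<close>
  have inj: "inj_on petal E"
    unfolding inj_on_def petal_def using x by blast
  have V: "V = insert x (\<Union>(petal ` E))"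
  proof (intro equalityI subsetI)
    fix u assume "u \<in> V"
    then show "u \<in> insert x (\<Union>(petal ` E))"
      using cover[of u] by (auto simp: petal_def)
  next
    fix u assume "u \<in> insert x (\<Union>(petal ` E))"
    then show "u \<in> V"
      using sub x \<open>E \<noteq> {}\<close> by (auto simp: petal_def)
  qed
  have fin: "finite e" if "e \<in> E" for e
    using sub that \<open>finite V\<close> finite_subset by blast
  have "finite E"
    using sub \<open>finite V\<close> by (meson Pow_iff finite_Pow_iff finite_subset subsetI)
  \<comment> \<open>This is where edges of size at least 2 enter.\<close>
  have petal_ne: "petal e \<noteq> {}" if "e \<in> E" for e
  proof
    assume "petal e = {}"
    then have "e = {x}"
      using x[OF that] by (auto simp: petal_def)
    then show False
      using card[OF that] by simp
  qed
  have "pairwise disjnt (petal ` E)"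
    unfolding pairwise_def disjnt_def petal_def using disj by blast
  moreover have "finite P \<and> P \<noteq> {}" if "P \<in> petal ` E" for P
    using that petal_ne fin by (auto simp: petal_def)
  ultimately obtain c s where "s \<in> set states_even" "realizes (petal ` E) c s"
    using exists_petals_labeling[of "petal ` E"] \<open>finite E\<close> by blast
  then obtain v e where ve: "(v, e) \<in> set states_even" and real: "realizes (petal ` E) c (v, e)"
    by (metis surj_pair)
  obtain i j where e: "flat e" and ij: "flat (bump i j v)"
    using flat_states_even ve by blast
  obtain k l where k: "\<And>a. vcount (\<Union>(petal ` E)) c a = k + quad_at v a"
    and l: "\<And>a. ecount (petal ` E) c a = l + quad_at e a"
    using real by (auto simp: realizes_def)
  define g :: grpA where "g = (of_bool i, of_bool j)"
  define c' where "c' = c(x := g)"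
  have vcount: "vcount V c' a = k + quad_at (bump i j v) a" for a
  proof -
    have x_notin: "x \<notin> \<Union>(petal ` E)"
      by (simp add: petal_def)
    have "{u\<in>V. c' u = a} = (if a = g then {x} else {}) \<union> {u\<in>\<Union>(petal ` E). c u = a}"
      unfolding V c'_def using x_notin by auto
    moreover have "finite {u\<in>\<Union>(petal ` E). c u = a}"
      using V \<open>finite V\<close> by (auto intro: rev_finite_subset)
    ultimately have "vcount V c' a = vcount (\<Union>(petal ` E)) c a + of_bool (a = g)"
      unfolding vcount_def using x_notin by (auto simp: card_insert_if)
    then show ?thesis
      by (simp add: k quad_at_bump g_def)
  qed
  \<comment> \<open>Every edge sum is its petal sum plus \<open>g\<close>. The edge counts are thus
    the petal counts permuted by a translation of the group, and \<open>flat e\<close> bounds their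
    differences for any pair of arguments.\<close>
  have ecount: "ecount E c' a = l + quad_at e (a - g)" for a
  proof -
    have "induced c' e = g + induced c (petal e)" if "e \<in> E" for e
    proof -
      have "induced c' e = c' x + (\<Sum>u\<in>petal e. c' u)"
        unfolding induced_def petal_def using sum.remove[OF fin[OF that] x[OF that]] .
      also have "(\<Sum>u\<in>petal e. c' u) = (\<Sum>u\<in>petal e. c u)"
        by (intro sum.cong) (auto simp: c'_def petal_def)
      finally show ?thesis
        by (simp add: c'_def induced_def)
    qed
    then have "petal ` {e\<in>E. induced c' e = a} = {P\<in>petal ` E. induced c P = a - g}"
      by (auto simp: eq_diff_eq add.commute)
    then have "ecount E c' a = ecount (petal ` E) c (a - g)"
      unfolding ecount_def
      by (metis (no_types, lifting) card_image inj inj_on_subset mem_Collect_eq subsetI)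
    then show ?thesis
      by (simp add: l)
  qed
  have "\<bar>int (vcount V c' a) - int (vcount V c' b)\<bar> \<le> 1" for a b
    using flat_le[OF ij, of a b] flat_le[OF ij, of b a] by (simp add: vcount)
  moreover have "\<bar>int (ecount E c' a) - int (ecount E c' b)\<bar> \<le> 1" for a b
    using flat_le[OF e, of "a - g" "b - g"] flat_le[OF e, of "b - g" "a - g"] by (simp add: ecount)
  ultimately show ?thesis
    unfolding A_cordial_def A_friendly_def by blast
qed

end
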